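(* Let $\mathcal{G}$ be a causal diagram with action $X \in \mathbf{O}$ and latent reward $Y \in \mathbf{L}$ that is a descendant of $X$, and let $\Pi$ be a policy space over $X$. Then $P(y)$ is imitable with respect to $\langle \mathcal{G}, \Pi\rangle$ if and only if there exists a set $\mathbf{Z}$ with $\mathbf{Z} \subseteq \mathrm{Pa}(\Pi)$ and $(Y \perp\!\!\!\perp X \mid \mathbf{Z})_{\mathcal{G}_{\underline{X}}}$ (a $\pi$-backdoor admissible set). Moreover, in that case the policy $\pi \in \Pi$ given by $\pi(x \mid \mathrm{pa}(\Pi)) = P(x \mid \mathbf{z})$ is an imitating policy.
   Context: A structural causal model (SCM) $M = \langle \mathbf{U}, \mathbf{V}, \mathcal{F}, P(\mathbf{u})\rangle$ has exogenous variables $\mathbf{U}$ drawn from $P(\mathbf{u})$, endogenous variables $\mathbf{V}$, and for each $V\in\mathbf{V}$ a function $V \leftarrow f_V(\mathrm{Pa}_V, U_V)$ with $\mathrm{Pa}_V \subseteq \mathbf{V}$, $U_V \subseteq \mathbf{U}$. A partially observable SCM (POSCM) is $\langle M, \mathbf{O}, \mathbf{L}\rangle$ with $\mathbf{O},\mathbf{L}$ a partition of $\mathbf{V}$ into observed and latent endogenous variables; $P(\mathbf{o})$ is the observational distribution. The causal diagram $\mathcal{G}$ of $M$ is the acyclic graph on $\mathbf{V}$ (nodes marked observed/latent) with an arrow $V_j \to V_i$ whenever $V_j \in \mathrm{Pa}_{V_i}$ and a bidirected arrow $V_i \leftrightarrow V_j$ whenever $U_{V_i}\cap U_{V_j}\neq\emptyset$;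 $\mathcal{M}_{\langle\mathcal{G}\rangle}$ is the class of POSCMs with causal diagram $\mathcal{G}$. $\mathcal{G}_{\overline{X}}$ (resp. $\mathcal{G}_{\underline{X}}$) is $\mathcal{G}$ with arrows into (resp. out of) $X$ removed; d-separation is the standard criterion (bidirected arrows act as latent common causes). A policy space $\Pi$ is determined by a covariate set $\mathrm{Pa}(\Pi) \subseteq \mathbf{O}\setminus \mathrm{De}(X)_{\mathcal{G}_{\overline{X}}}$ and consists of all maps $\pi(x\mid \mathrm{pa}(\Pi))$ from values of $\mathrm{Pa}(\Pi)$ to distributions over $X$. The intervention $\mathrm{do}(\pi)$ replaces $f_X$ by drawing $X$ from $\pi$, giving $P(\mathbf{v}\mid \mathrm{do}(\pi)) = \sum_{\mathbf{u}} P(\mathbf{u}) \prod_{V\neq X} P(v\mid \mathrm{pa}_V, u_V)\,\pi(x\mid \mathrm{pa}(\Pi))$. For $\mathbf{Y}\subseteq \mathbf{V}$, $P(\mathbf{y})$ is imitable w.r.t. $\langle\mathcal{G},\Pi\rangle$ if there is a policy $\pi\in\Pi$ uniquely computable from $P(\mathbf{o})$ such that $P(\mathbf{y}\mid \mathrm{do}(\pi);M) = P(\mathbf{y};M)$ for every POSCM $M\in\mathcal{M}_{\langle\mathcal{G}\rangle}$; such $\pi$ is an imitating policy.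
   Formalization: The exogenous variables U are taken to be mutually independent (and all variables discrete, as the sum over u suggests); without independence, variables sharing no exogenous argument could still be confounded and the criterion would fail. *)

theory Defs
  imports "HOL-Probability.Probability"
begin

text \<open>A causal diagram on the finite node type 'v is given by a directed edge relation
  dir (dir a b means a \<rightarrow> b) and a bidirected edge relation bi (a \<leftrightarrow> b).\<close>

definition causal_diagram :: "('v \<Rightarrow> 'v \<Rightarrow> bool) \<Rightarrow> ('v \<Rightarrow> 'v \<Rightarrow> bool) \<Rightarrow> bool" where
  "causal_diagram dir bi \<longleftrightarrow> (\<forall>v. \<not> dir\<^sup>+\<^sup>+ v v) \<and> symp bi \<and> irreflp bi"

definition bar_graph :: "('v \<Rightarrow> 'v \<Rightarrow> bool) \<Rightarrow> 'v \<Rightarrow> 'v \<Rightarrow> 'v \<Rightarrow> bool" where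
  "bar_graph dir X = (\<lambda>a b. dir a b \<and> b \<noteq> X)"

definition underline_graph :: "('v \<Rightarrow> 'v \<Rightarrow> bool) \<Rightarrow> 'v \<Rightarrow> 'v \<Rightarrow> 'v \<Rightarrow> bool" where
  "underline_graph dir X = (\<lambda>a b. dir a b \<and> a \<noteq> X)"

definition descendants :: "('v \<Rightarrow> 'v \<Rightarrow> bool) \<Rightarrow> 'v \<Rightarrow> 'v set" where
  "descendants dir a = {w. dir\<^sup>*\<^sup>* a w}"

datatype edge_kind = Fwd | Bwd | Bid

definition edge_ok :: "('v \<Rightarrow> 'v \<Rightarrow> bool) \<Rightarrow> ('v \<Rightarrow> 'v \<Rightarrow> bool) \<Rightarrow> 'v \<Rightarrow> edge_kind \<Rightarrow> 'v \<Rightarrow> bool" where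
  "edge_ok dir bi a e b = (case e of Fwd \<Rightarrow> dir a b | Bwd \<Rightarrow> dir b a | Bid \<Rightarrow> bi a b)"

definition head_right :: "edge_kind \<Rightarrow> bool" where "head_right e \<longleftrightarrow> e \<noteq> Bwd"
definition head_left :: "edge_kind \<Rightarrow> bool" where "head_left e \<longleftrightarrow> e \<noteq> Fwd"

definition is_path :: "('v \<Rightarrow> 'v \<Rightarrow> bool) \<Rightarrow> ('v \<Rightarrow> 'v \<Rightarrow> bool) \<Rightarrow> 'v list \<Rightarrow> edge_kind list \<Rightarrow> bool" where
  "is_path dir bi ns es \<longleftrightarrow> length ns = Suc (length es) \<and> distinct ns \<and>
     (\<forall>i < length es. edge_ok dir bi (ns ! i) (es ! i) (ns ! Suc i))"

definition blocked :: "('v \<Rightarrow> 'v \<Rightarrow> bool) \<Rightarrow> 'v set \<Rightarrow> 'v list \<Rightarrow> edge_kind list \<Rightarrow> bool" where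
  "blocked dir Z ns es \<longleftrightarrow> (\<exists>i. 0 < i \<and> i < length es \<and>
     (let collider = (head_right (es ! (i - 1)) \<and> head_left (es ! i)) in
       (\<not> collider \<and> ns ! i \<in> Z) \<or> (collider \<and> descendants dir (ns ! i) \<inter> Z = {})))"

definition dsep :: "('v \<Rightarrow> 'v \<Rightarrow> bool) \<Rightarrow> ('v \<Rightarrow> 'v \<Rightarrow> bool) \<Rightarrow> 'v set \<Rightarrow> 'v set \<Rightarrow> 'v set \<Rightarrow> bool" where
  "dsep dir bi A B Z \<longleftrightarrow> (\<forall>ns es. is_path dir bi ns es \<and> hd ns \<in> A \<and> last ns \<in> B \<longrightarrow> blocked dir Z ns es)"

text \<open>Endogenous variables are the elements of the (finite) type 'v; exogenous variables are
  named by natural numbers; all variables take values in nat (discrete variables).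
  Exogenous variables are mutually independent, each U_i with its own distribution.
  The mechanism fn V receives the full endogenous and exogenous assignment but is required
  to depend only on Pa_V and U_V.\<close>

record 'v scm =
  pa :: "'v \<Rightarrow> 'v set"
  uv :: "'v \<Rightarrow> nat set"
  pu :: "nat \<Rightarrow> nat pmf"
  fn :: "'v \<Rightarrow> ('v \<Rightarrow> nat) \<Rightarrow> (nat \<Rightarrow> nat) \<Rightarrow> nat"

definition in_class :: "('v \<Rightarrow> 'v \<Rightarrow> bool) \<Rightarrow> ('v \<Rightarrow> 'v \<Rightarrow> bool) \<Rightarrow> 'v scm \<Rightarrow> bool" where
  "in_class dir bi M \<longleftrightarrow>
     (\<forall>V. pa M V = {W. dir W V}) \<and>
     (\<forall>V W. V \<noteq> W \<longrightarrow> (uv M V \<inter> uv M W \<noteq> {} \<longleftrightarrow> bi V W)) \<and>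
     (\<forall>V. finite (uv M V)) \<and>
     (\<forall>V v v' u u'. (\<forall>W\<in>pa M V. v W = v' W) \<longrightarrow> (\<forall>i\<in>uv M V. u i = u' i) \<longrightarrow>
        fn M V v u = fn M V v' u')"

definition exo_dist :: "'v scm \<Rightarrow> (nat \<Rightarrow> nat) pmf" where
  "exo_dist M = Pi_pmf (\<Union>V. uv M V) 0 (pu M)"

text \<open>Solution of the model for given exogenous values (unique by acyclicity).\<close>
definition solve :: "'v scm \<Rightarrow> (nat \<Rightarrow> nat) \<Rightarrow> 'v \<Rightarrow> nat" where
  "solve M u = (THE v. \<forall>V. v V = fn M V v u)"

definition solve_do :: "'v scm \<Rightarrow> 'v \<Rightarrow> (nat \<Rightarrow> nat) \<Rightarrow> nat \<Rightarrow> 'v \<Rightarrow> nat" where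
  "solve_do M X u x = (THE v. v X = x \<and> (\<forall>V. V \<noteq> X \<longrightarrow> v V = fn M V v u))"

definition obs_dist :: "'v scm \<Rightarrow> ('v \<Rightarrow> nat) pmf" where
  "obs_dist M = map_pmf (solve M) (exo_dist M)"

definition obs_dist_O :: "'v scm \<Rightarrow> 'v set \<Rightarrow> ('v \<Rightarrow> nat) pmf" where
  "obs_dist_O M Obs = map_pmf (\<lambda>v. restrict v Obs) (obs_dist M)"

type_synonym 'v policy = "('v \<Rightarrow> nat) \<Rightarrow> nat pmf"

definition policy_space :: "'v set \<Rightarrow> 'v policy set" where
  "policy_space PaPi = {\<pi>. \<forall>w w'. (\<forall>V\<in>PaPi. w V = w' V) \<longrightarrow> \<pi> w = \<pi> w'}"

text \<open>Interventional distribution P(v | do(pi)): draw u, evaluate the policy covariates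
  (non-descendants of X, so their values do not depend on the value plugged in for X),
  draw x from pi, then solve the mutilated model.\<close>
definition do_dist :: "'v scm \<Rightarrow> 'v \<Rightarrow> 'v policy \<Rightarrow> ('v \<Rightarrow> nat) pmf" where
  "do_dist M X \<pi> = exo_dist M \<bind> (\<lambda>u. \<pi> (solve_do M X u 0) \<bind> (\<lambda>x. return_pmf (solve_do M X u x)))"

definition imitating_map ::
  "('v \<Rightarrow> 'v \<Rightarrow> bool) \<Rightarrow> ('v \<Rightarrow> 'v \<Rightarrow> bool) \<Rightarrow> 'v set \<Rightarrow> 'v \<Rightarrow> 'v \<Rightarrow> 'v set \<Rightarrow>
    (('v \<Rightarrow> nat) pmf \<Rightarrow> 'v policy) \<Rightarrow> bool" where
  "imitating_map dir bi Obs X Y PaPi \<Phi> \<longleftrightarrow>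
     (\<forall>M. in_class dir bi M \<longrightarrow>
        \<Phi> (obs_dist_O M Obs) \<in> policy_space PaPi \<and>
        map_pmf (\<lambda>v. v Y) (do_dist M X (\<Phi> (obs_dist_O M Obs))) = map_pmf (\<lambda>v. v Y) (obs_dist M))"

definition imitable ::
  "('v \<Rightarrow> 'v \<Rightarrow> bool) \<Rightarrow> ('v \<Rightarrow> 'v \<Rightarrow> bool) \<Rightarrow> 'v set \<Rightarrow> 'v \<Rightarrow> 'v \<Rightarrow> 'v set \<Rightarrow> bool" where
  "imitable dir bi Obs X Y PaPi \<longleftrightarrow> (\<exists>\<Phi>. imitating_map dir bi Obs X Y PaPi \<Phi>)"

text \<open>The policy pi(x | pa(Pi)) = P(x | z) computed from P(o); for z of probability zero
  (never reached) an arbitrary fixed default is used.\<close>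
definition cond_policy :: "'v \<Rightarrow> 'v set \<Rightarrow> ('v \<Rightarrow> nat) pmf \<Rightarrow> 'v policy" where
  "cond_policy X Z P = (\<lambda>w. let S = {a. \<forall>V\<in>Z. a V = w V} in
     if set_pmf P \<inter> S \<noteq> {} then map_pmf (\<lambda>a. a X) (cond_pmf P S) else return_pmf 0)"

end

theory Submission
  imports Defs
begin

text \<open>Sufficiency. If the children of \<open>X\<close> read a constant \<open>x\<close>, the model becomes compatible with the
  diagram without the arrows out of \<open>X\<close>, so d-separation makes the reward under \<open>do(x)\<close> independent of
  the natural action given \<open>Z\<close>; averaging over \<open>P(x | z)\<close> then restores \<open>P(y)\<close>. D-separation implies
  independence because, for fixed \<open>z\<close>, the mechanisms of the ancestors of \<open>X\<close>, \<open>Y\<close> and \<open>Z\<close> split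
  into those reached from \<open>Y\<close> by active walks and the others; the two parts share no exogenous variable
  and no endogenous variable outside \<open>Z\<close>.

  Necessity. If no subset of \<open>Pa(\<Pi>)\<close> is admissible, there is an active path from \<open>Y\<close> to \<open>X\<close> given
  \<open>Pa(\<Pi>) \<inter> An(Y)\<close>. All its nodes are ancestors of \<open>Y\<close> and all tails of its directed edges are
  invisible to the policy. Each edge of the path carries a fair coin known to both of its ends; every
  node of the path adds the parity of its coins to a counter that is passed on towards \<open>Y\<close>. The natural
  counter of \<open>Y\<close> counts each coin twice and is always even. Turning all coins from 0 to 1 changes nothing
  the policy sees, but shifts the counter of \<open>Y\<close> under \<open>do(x)\<close> by one, so no policy keeps it even.\<close>

section \<open>Solutions of acyclic models\<close>

lemma acyclic_wfp:
  fixes dir :: "'v::finite \<Rightarrow> 'v \<Rightarrow> bool"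
  assumes "\<forall>v. \<not> dir\<^sup>+\<^sup>+ v v"
  shows "wfp dir"
proof -
  have "acyclic {(a, b). dir a b}"
    using assms by (auto simp: acyclic_def tranclp_unfold)
  then have "wf {(a, b). dir a b}" by (intro finite_acyclic_wf) auto
  then show ?thesis by (simp add: wfp_def)
qed

text \<open>Induction along \<open>dir\<close> never leaves the parent-closed \<open>S\<close>. By
  this principle solutions of different models or interventions are compared.\<close>

lemma parent_closed_agree:
  assumes "wfp dir" and "\<And>V W. V \<in> S \<Longrightarrow> dir W V \<Longrightarrow> W \<in> S"
    and "\<And>V. V \<in> S \<Longrightarrow> (\<And>W. dir W V \<Longrightarrow> v W = v' W) \<Longrightarrow> v V = v' V"
    and "V \<in> S"
  shows "v V = v' V"
  using assms(1,4)
  by (induction V rule: wfp_induct_rule) (use assms(2,3) in blast)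

lemma ex1_solution:
  fixes F :: "'v \<Rightarrow> ('v \<Rightarrow> 'a) \<Rightarrow> 'a"
  assumes wf: "wfp dir" and loc: "\<And>V v v'. (\<And>W. dir W V \<Longrightarrow> v W = v' W) \<Longrightarrow> F V v = F V v'"
  shows "\<exists>!v. \<forall>V. v V = F V v"
proof (rule ex_ex1I)
  let ?r = "{(a, b). dir a b}"
  define v where "v = wfrec ?r (\<lambda>g V. F V g)"
  have "v V = F V v" for V
  proof -
    have "v V = F V (cut v ?r V)"
      using wf unfolding v_def wfp_def by (rule wfrec)
    also have "\<dots> = F V v" by (rule loc) (simp add: cut_apply)
    finally show ?thesis .
  qed
  then show "\<exists>v. \<forall>V. v V = F V v" by blast
next
  fix v v' assume "\<forall>V. v V = F V v" "\<forall>V. v' V = F V v'"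
  then have "v V = v' V" for V
    using parent_closed_agree[OF wf, of UNIV v v' V] loc[of V v v'] by (metis UNIV_I loc)
  then show "v = v'" by blast
qed

lemma in_class_fn_cong:
  assumes "in_class dir bi M" and "\<And>W. dir W V \<Longrightarrow> v W = v' W" and "\<And>i. i \<in> uv M V \<Longrightarrow> u i = u' i"
  shows "fn M V v u = fn M V v' u'"
  using assms unfolding in_class_def by (metis mem_Collect_eq)

lemma solve_eq:
  assumes "wfp dir" and "in_class dir bi M"
  shows "solve M u V = fn M V (solve M u) u"
proof -
  have "\<exists>!v. \<forall>V. v V = fn M V v u"
    by (rule ex1_solution[OF assms(1)]) (use in_class_fn_cong[OF assms(2)] in metis)
  from theI'[OF this] show ?thesis unfolding solve_def by blast
qed

lemma solve_do_eq:
  assumes "wfp dir" and "in_class dir bi M"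
  shows "solve_do M X u x V = (if V = X then x else fn M V (solve_do M X u x) u)"
proof -
  have "\<exists>!v. \<forall>V. v V = (if V = X then x else fn M V v u)"
    by (rule ex1_solution[OF assms(1)]) (use in_class_fn_cong[OF assms(2)] in metis)
  moreover have "(\<forall>V. v V = (if V = X then x else fn M V v u)) \<longleftrightarrow>
      (v X = x \<and> (\<forall>V. V \<noteq> X \<longrightarrow> v V = fn M V v u))" for v by auto
  ultimately have "\<exists>!v. v X = x \<and> (\<forall>V. V \<noteq> X \<longrightarrow> v V = fn M V v u)" by simp
  from theI'[OF this] show ?thesis unfolding solve_do_def by auto
qed

section \<open>Active walks\<close>

text \<open>The negation of one clause of \<open>blocked\<close>, with the incoming edge reduced to
  the flag \<open>h\<close> (it points at \<open>V\<close>), so that walks can grow one edge at a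
  time.\<close>

definition opened :: "('v \<Rightarrow> 'v \<Rightarrow> bool) \<Rightarrow> 'v set \<Rightarrow> bool \<Rightarrow> 'v \<Rightarrow> edge_kind \<Rightarrow> bool" where
  "opened dir Z h V e \<longleftrightarrow> (if h \<and> head_left e then descendants dir V \<inter> Z \<noteq> {} else V \<notin> Z)"

text \<open>Nodes may repeat, unlike in \<open>is_path\<close>, so extending a walk by an edge needs
  no distinctness check.\<close>

definition active_walk :: "('v \<Rightarrow> 'v \<Rightarrow> bool) \<Rightarrow> ('v \<Rightarrow> 'v \<Rightarrow> bool) \<Rightarrow> 'v set \<Rightarrow>
    nat \<Rightarrow> (nat \<Rightarrow> 'v) \<Rightarrow> (nat \<Rightarrow> edge_kind) \<Rightarrow> bool" where
  "active_walk dir bi Z n f g \<longleftrightarrow>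
     (\<forall>k<n. edge_ok dir bi (f k) (g k) (f (Suc k))) \<and>
     (\<forall>k. 0 < k \<longrightarrow> k < n \<longrightarrow> opened dir Z (head_right (g (k - 1))) (f k) (g k))"

lemma descendants_run:
  assumes "\<And>k. i \<le> k \<Longrightarrow> k < m \<Longrightarrow> dir (f k) (f (Suc k))" and "i \<le> m"
  shows "dir\<^sup>*\<^sup>* (f i) (f m)"
  using assms(2,1) by (induction m rule: dec_induct) (auto intro: rtranclp.rtrancl_into_rtrancl)

text \<open>Cutting a loop out of an active walk leaves an active walk: if the junction becomes a collider
  although it was none before, the loop starts with a directed run that stops at a collider.\<close>

lemma active_walk_cut:
  assumes w: "active_walk dir bi Z n f g" and ij: "i < j" "j \<le> n" "f i = f j"
  defines "d \<equiv> j - i"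
  shows "active_walk dir bi Z (n - d) (\<lambda>k. if k \<le> i then f k else f (k + d)) (\<lambda>k. if k < i then g k else g (k + d))"
    (is "active_walk _ _ _ _ ?f ?g")
proof -
  have edge: "\<And>k. k < n \<Longrightarrow> edge_ok dir bi (f k) (g k) (f (Suc k))"
    and op: "\<And>k. 0 < k \<Longrightarrow> k < n \<Longrightarrow> opened dir Z (head_right (g (k - 1))) (f k) (g k)"
    using w by (auto simp: active_walk_def)
  have d: "i + d = j" "d > 0" using ij by (auto simp: d_def)
  have "edge_ok dir bi (?f k) (?g k) (?f (Suc k))" if "k < n - d" for k
  proof (cases "k < i")
    case True then show ?thesis using edge[of k] that by auto
  next
    case False
    then have "?f k = f (k + d)" using d ij by (cases "k = i") auto
    then show ?thesis using False edge[of "k + d"] that by auto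
  qed
  moreover have "opened dir Z (head_right (?g (k - 1))) (?f k) (?g k)" if k: "0 < k" "k < n - d" for k
  proof -
    consider "k < i" | "k = i" | "k > i" by linarith
    then show ?thesis
    proof cases
      case 1 then show ?thesis using op[of k] k by auto
    next
      case 3 then show ?thesis using op[of "k + d"] k
        by (auto simp: Suc_diff_Suc)
    next
      case 2
      have j: "0 < j" "j < n" and i: "0 < i" "i < n" using k 2 d ij by auto
      show ?thesis
      proof (cases "head_right (g (i - 1)) \<and> head_left (g j)")
        \<comment> \<open>No collider after the cut: the kept edge without a head at
          \<open>f i\<close> already made the visit at \<open>i\<close> or at \<open>j\<close> a
          non-collider.\<close>
        case False
        then have "f i \<notin> Z" using op[OF i] op[OF j] ij by (auto simp: opened_def split: if_splits)
        then show ?thesis using False 2 i d by (auto simp: opened_def)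
      next
        case True
        have "descendants dir (f i) \<inter> Z \<noteq> {}"
        proof (cases "head_left (g i) \<or> head_right (g (j - 1))")
          case True': True
          then show ?thesis using op[OF i] op[OF j] ij True by (auto simp: opened_def)
        next
          case False
          then have gi: "g i = Fwd" "g (j - 1) \<noteq> Fwd" by (auto simp: head_left_def head_right_def)
          define m where "m = (LEAST m. i < m \<and> g m \<noteq> Fwd)"
          have im: "i < j - 1" using gi ij by (cases "i = j - 1") auto
          then have m: "i < m" "g m \<noteq> Fwd" "m \<le> j - 1"
            using LeastI[of "\<lambda>m. i < m \<and> g m \<noteq> Fwd" "j - 1"] Least_le[of "\<lambda>m. i < m \<and> g m \<noteq> Fwd" "j - 1"] gi
            by (auto simp: m_def)
          have fw: "g k = Fwd" if "i \<le> k" "k < m" for k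
            using not_less_Least[of k "\<lambda>m. i < m \<and> g m \<noteq> Fwd"] that gi by (cases "k = i") (auto simp: m_def)
          have mn: "m < n" using m ij by linarith
          have "dir\<^sup>*\<^sup>* (f i) (f m)"
          proof (rule descendants_run)
            fix k assume "i \<le> k" "k < m"
            then show "dir (f k) (f (Suc k))" using fw[of k] edge[of k] mn by (auto simp: edge_ok_def)
          qed (use m in simp)
          moreover obtain T where "dir\<^sup>*\<^sup>* (f m) T" "T \<in> Z"
            using op[of m] m mn fw[of "m - 1"] by (auto simp: opened_def head_left_def head_right_def descendants_def)
          ultimately have "T \<in> descendants dir (f i) \<inter> Z" by (auto simp: descendants_def)
          then show ?thesis by blast
        qed
        then show ?thesis using True 2 i d by (auto simp: opened_def)
      qed
    qed
  qed
  ultimately show ?thesis by (auto simp: active_walk_def)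
qed

text \<open>A shortest active walk between the two ends repeats no node, since
  \<open>active_walk_cut\<close> would shorten it; hence it is an unblocked path.\<close>

lemma active_walk_not_dsep:
  assumes "active_walk dir bi Z n f g"
  shows "\<not> dsep dir bi {f 0} {f n} Z"
proof -
  define P where "P m \<longleftrightarrow> (\<exists>f' g'. active_walk dir bi Z m f' g' \<and> f' 0 = f 0 \<and> f' m = f n)" for m
  have "P n" using assms by (auto simp: P_def)
  define m where "m = (LEAST m. P m)"
  have "P m" using \<open>P n\<close> unfolding m_def by (rule LeastI)
  then obtain f' g' where w: "active_walk dir bi Z m f' g'" and ends: "f' 0 = f 0" "f' m = f n"
    by (auto simp: P_def)
  have inj: "inj_on f' {..m}"
  proof (rule ccontr)
    assume "\<not> inj_on f' {..m}"
    then obtain i j where ij: "i < j" "j \<le> m" "f' i = f' j"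
      by (auto simp: inj_on_def) (metis linorder_neqE_nat)
    have "P (m - (j - i))"
      unfolding P_def by (rule exI, rule exI, rule conjI, rule active_walk_cut[OF w ij])
        (use ij ends in \<open>cases "j = m"; auto\<close>)
    then have "m \<le> m - (j - i)" unfolding m_def by (rule Least_le)
    then show False using ij by auto
  qed
  let ?ns = "map f' [0..<Suc m]" and ?es = "map g' [0..<m]"
  have "is_path dir bi ?ns ?es"
    using w inj by (auto simp: is_path_def active_walk_def distinct_map inj_on_def nth_append simp del: upt_Suc)
  moreover have "\<not> blocked dir Z ?ns ?es"
    using w by (auto simp: blocked_def active_walk_def Let_def opened_def nth_append split: if_splits simp del: upt_Suc)
  moreover have "hd ?ns = f 0" "last ?ns = f n"
    using ends by (auto simp: hd_map simp del: upt_Suc) (simp add: last_map)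
  ultimately show ?thesis by (auto simp: dsep_def simp del: upt_Suc)
qed

text \<open>The Boolean records whether the last edge of the walk points at the node reached.\<close>

inductive reach :: "('v \<Rightarrow> 'v \<Rightarrow> bool) \<Rightarrow> ('v \<Rightarrow> 'v \<Rightarrow> bool) \<Rightarrow> 'v set \<Rightarrow> 'v \<Rightarrow> 'v \<Rightarrow> bool \<Rightarrow> bool"
  for dir bi Z Y where
  start: "reach dir bi Z Y Y False"
| step: "reach dir bi Z Y V h \<Longrightarrow> edge_ok dir bi V e W \<Longrightarrow> opened dir Z h V e \<Longrightarrow>
    reach dir bi Z Y W (head_right e)"

lemma reach_walk:
  assumes "reach dir bi Z Y V h"
  shows "\<exists>n f g. active_walk dir bi Z n f g \<and> f 0 = Y \<and> f n = V \<and> (n > 0 \<longrightarrow> head_right (g (n - 1)) = h)"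
  using assms
proof induction
  case start
  show ?case by (rule exI[of _ 0]) (auto simp: active_walk_def)
next
  case (step V h e W)
  then obtain n f g where "active_walk dir bi Z n f g" "f 0 = Y" "f n = V" "n > 0 \<longrightarrow> head_right (g (n - 1)) = h"
    by blast
  with step.hyps show ?case
    by (intro exI[of _ "Suc n"] exI[of _ "f(Suc n := W)"] exI[of _ "g(n := e)"])
      (auto simp: active_walk_def less_Suc_eq)
qed

lemma dsep_not_reach:
  assumes "dsep dir bi {Y} {X} Z"
  shows "\<not> reach dir bi Z Y X h"
  using assms reach_walk active_walk_not_dsep by metis

section \<open>D-separation and conditional independence\<close>

lemma reach_up:
  assumes "dir\<^sup>*\<^sup>* V Y" and "\<And>W. dir\<^sup>*\<^sup>* V W \<Longrightarrow> W \<notin> Z"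
  shows "reach dir bi Z Y V False"
  using assms
proof (induction rule: converse_rtranclp_induct)
  case base
  show ?case by (rule reach.start)
next
  case (step V W)
  then have "reach dir bi Z Y W False" by (meson converse_rtranclp_into_rtranclp)
  moreover have "W \<notin> Z" using step by blast
  ultimately show ?case
    using reach.step[of dir bi Z Y W False Bwd V] step.hyps by (auto simp: edge_ok_def opened_def head_right_def)
qed

lemma reach_down:
  assumes "dir\<^sup>*\<^sup>* V X" and "\<And>W. dir\<^sup>*\<^sup>* V W \<Longrightarrow> W \<notin> Z" and "reach dir bi Z Y V h"
  shows "\<exists>h. reach dir bi Z Y X h"
  using assms
proof (induction arbitrary: h rule: converse_rtranclp_induct)
  case (step V W)
  have "V \<notin> Z" using step.prems by blast
  then have "reach dir bi Z Y W True"
    using reach.step[OF step.prems(2), of Fwd W] step.hyps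
    by (auto simp: edge_ok_def opened_def head_left_def head_right_def)
  then show ?case using step by (meson converse_rtranclp_into_rtranclp)
qed blast

text \<open>The mechanisms on the side of \<open>Y\<close>: two mechanisms that share an exogenous variable, or an
  endogenous one outside \<open>Z\<close>, lie on the same side.\<close>

definition side :: "('v \<Rightarrow> 'v \<Rightarrow> bool) \<Rightarrow> ('v \<Rightarrow> 'v \<Rightarrow> bool) \<Rightarrow> 'v set \<Rightarrow> 'v \<Rightarrow> 'v set" where
  "side dir bi Z Y = {V. \<exists>h. reach dir bi Z Y V h \<and> (h \<or> V \<notin> Z)}"

lemma side_child:
  assumes "V \<in> side dir bi Z Y" "V \<notin> Z" "dir V W"
  shows "W \<in> side dir bi Z Y"
  using assms reach.step[of dir bi Z Y V _ Fwd W]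
  by (fastforce simp: side_def edge_ok_def opened_def head_left_def head_right_def)

text \<open>If \<open>V\<close> has a descendant in \<open>Z\<close>, the walk may leave
  \<open>V\<close> through any edge with a head at \<open>V\<close>. Otherwise \<open>V\<close> is
  an ancestor of \<open>X\<close> or \<open>Y\<close>. Descending to \<open>X\<close> would reach
  it, so \<open>V\<close> is an ancestor of \<open>Y\<close> and is also reached by climbing from
  \<open>Y\<close>, which makes it a non-collider.\<close>

lemma side_into:
  assumes V: "V \<in> side dir bi Z Y" and anc: "dir\<^sup>*\<^sup>* V T" "T \<in> {X, Y} \<union> Z"
    and nr: "\<And>h. \<not> reach dir bi Z Y X h" and e: "edge_ok dir bi V e W" "head_left e"
  shows "reach dir bi Z Y W (head_right e)"
proof -
  obtain h where h: "reach dir bi Z Y V h" "h \<or> V \<notin> Z" using V by (auto simp: side_def)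
  show ?thesis
  proof (cases "descendants dir V \<inter> Z = {}")
    case True
    then have nz: "\<And>W. dir\<^sup>*\<^sup>* V W \<Longrightarrow> W \<notin> Z" by (auto simp: descendants_def)
    have "T \<noteq> X" using reach_down[OF _ nz h(1)] anc nr by blast
    then have "T = Y" using anc nz by blast
    then have "reach dir bi Z Y V False" using anc nz by (metis reach_up)
    moreover have "V \<notin> Z" using nz by blast
    ultimately show ?thesis using e reach.step[of dir bi Z Y V False e W] by (auto simp: opened_def)
  next
    case False
    then have "opened dir Z h V e" using h(2) e(2) by (cases h) (auto simp: opened_def)
    then show ?thesis by (rule reach.step[OF h(1) e(1)])
  qed
qed

text \<open>Split the product at \<open>J\<close>: \<open>E\<close> is determined by the block
  \<open>I \<inter> J\<close> and \<open>F\<close> by the rest. Outside its block each part holds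
  the default \<open>d\<close>, which covers indices of \<open>J\<close> outside
  \<open>I\<close>.\<close>

lemma Pi_pmf_indep_events:
  fixes E F :: "('i \<Rightarrow> 'a) \<Rightarrow> bool"
  assumes "finite I" and "J \<inter> K = {}"
    and E: "\<And>u u'. (\<And>i. i \<in> J \<Longrightarrow> u i = u' i) \<Longrightarrow> E u = E u'"
    and F: "\<And>u u'. (\<And>i. i \<in> K \<Longrightarrow> u i = u' i) \<Longrightarrow> F u = F u'"
  shows "measure_pmf.prob (Pi_pmf I d p) {u. E u \<and> F u} =
    measure_pmf.prob (Pi_pmf I d p) {u. E u} * measure_pmf.prob (Pi_pmf I d p) {u. F u}"
proof -
  let ?A = "I \<inter> J" and ?B = "I - J"
  let ?h = "\<lambda>(f, g) i. if i \<in> ?A then f i else g i"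
  have "I = ?A \<union> ?B" by blast
  then have *: "Pi_pmf I d p = map_pmf ?h (pair_pmf (Pi_pmf ?A d p) (Pi_pmf ?B d p))"
    using Pi_pmf_union[of ?A ?B d p] assms(1) by auto
  have d1: "f i = d" if "f \<in> set_pmf (Pi_pmf ?A d p)" "i \<notin> ?A" for f i
    using that assms(1) by (auto simp: set_Pi_pmf PiE_dflt_def)
  have d2: "f i = d" if "f \<in> set_pmf (Pi_pmf ?B d p)" "i \<notin> ?B" for f i
    using that assms(1) by (auto simp: set_Pi_pmf PiE_dflt_def)
  have EF: "map_pmf (\<lambda>u. (E u, F u)) (Pi_pmf I d p) = pair_pmf (map_pmf E (Pi_pmf ?A d p)) (map_pmf F (Pi_pmf ?B d p))"
  proof -
    have "map_pmf (\<lambda>u. (E u, F u)) (Pi_pmf I d p) =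
      map_pmf (\<lambda>(f, g). (E f, F g)) (pair_pmf (Pi_pmf ?A d p) (Pi_pmf ?B d p))"
      unfolding * pmf.map_comp
    proof (rule map_pmf_cong[OF refl], clarsimp, rule conjI)
      fix f g assume fg: "f \<in> set_pmf (Pi_pmf ?A d p)" "g \<in> set_pmf (Pi_pmf ?B d p)"
      show "E (\<lambda>i. if i \<in> I \<and> i \<in> J then f i else g i) = E f"
        by (rule E) (use d1[OF fg(1)] d2[OF fg(2)] in auto)
      show "F (\<lambda>i. if i \<in> I \<and> i \<in> J then f i else g i) = F g"
        by (rule F) (use assms(2) in auto)
    qed
    then show ?thesis by (simp add: map_pair)
  qed
  have Em: "map_pmf E (Pi_pmf I d p) = map_pmf E (Pi_pmf ?A d p)"
    using arg_cong[OF EF, of "map_pmf fst"] by (simp add: pmf.map_comp o_def map_fst_pair_pmf)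
  have Fm: "map_pmf F (Pi_pmf I d p) = map_pmf F (Pi_pmf ?B d p)"
    using arg_cong[OF EF, of "map_pmf snd"] by (simp add: pmf.map_comp o_def map_snd_pair_pmf)
  have "pmf (map_pmf (\<lambda>u. (E u, F u)) (Pi_pmf I d p)) (True, True) =
      pmf (map_pmf E (Pi_pmf I d p)) True * pmf (map_pmf F (Pi_pmf I d p)) True"
    unfolding EF Em Fm by (simp add: pmf_pair)
  then show ?thesis by (simp add: pmf_map vimage_def)
qed

text \<open>Conditional independence without division. All four events have the form
  \<open>E b u \<and> F a u\<close> with independent factors, so both sides are the same product of
  four probabilities.\<close>

lemma dsep_cond_indep:
  fixes M :: "'v::finite scm"
  assumes wf: "wfp dir" and cl: "in_class dir bi M" and ds: "dsep dir bi {Y} {X} Z" and YZ: "Y \<notin> Z"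
  defines "S \<equiv> solve M" and "\<P> \<equiv> (\<lambda>Q. measure_pmf.prob (exo_dist M) {u. Q u})"
  shows "\<P> (\<lambda>u. (\<forall>V\<in>Z. S u V = z V) \<and> S u X = x \<and> S u Y = y) * \<P> (\<lambda>u. \<forall>V\<in>Z. S u V = z V) =
    \<P> (\<lambda>u. (\<forall>V\<in>Z. S u V = z V) \<and> S u X = x) * \<P> (\<lambda>u. (\<forall>V\<in>Z. S u V = z V) \<and> S u Y = y)"
proof -
  have nr: "\<And>h. \<not> reach dir bi Z Y X h" using dsep_not_reach[OF ds] .
  define A where "A = {V. \<exists>T\<in>{X, Y} \<union> Z. dir\<^sup>*\<^sup>* V T}"
  define C where "C = A \<inter> side dir bi Z Y"
  define D where "D = A - side dir bi Z Y"
  have A_par: "W \<in> A" if "V \<in> A" "dir W V" for V W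
    using that by (auto simp: A_def intro: converse_rtranclp_into_rtranclp)
  have A_in: "X \<in> A" "Y \<in> A" "Z \<subseteq> A" by (auto simp: A_def)
  have YC: "Y \<in> C" using A_in YZ by (auto simp: C_def side_def intro: reach.start)
  have XD: "X \<in> D" using A_in nr by (auto simp: D_def side_def)
  have C_par: "W \<in> C" if "V \<in> C" "dir W V" "W \<notin> Z" for V W
  proof -
    obtain T where "dir\<^sup>*\<^sup>* V T" "T \<in> {X, Y} \<union> Z" using \<open>V \<in> C\<close> by (auto simp: C_def A_def)
    then have "reach dir bi Z Y W (head_right Bwd)"
      using side_into[of V dir bi Z Y T X Bwd W] that nr by (auto simp: C_def edge_ok_def head_left_def)
    then show ?thesis using that A_par by (auto simp: C_def side_def)
  qed
  have D_par: "W \<in> D" if "V \<in> D" "dir W V" "W \<notin> Z" for V W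
    using that side_child[of W dir bi Z Y V] A_par by (auto simp: D_def)
  have no_bi: "\<not> bi V W" if "V \<in> C" "W \<in> D" for V W
  proof
    assume b: "bi V W"
    obtain T where "dir\<^sup>*\<^sup>* V T" "T \<in> {X, Y} \<union> Z" using \<open>V \<in> C\<close> by (auto simp: C_def A_def)
    then have "reach dir bi Z Y W True"
      using side_into[of V dir bi Z Y T X Bid W] that nr b by (auto simp: C_def edge_ok_def head_left_def head_right_def)
    then show False using that by (auto simp: D_def side_def)
  qed
  have disj: "(\<Union>V\<in>C. uv M V) \<inter> (\<Union>V\<in>D. uv M V) = {}"
  proof -
    have "uv M V \<inter> uv M W = {}" if "V \<in> C" "W \<in> D" for V W
    proof -
      have "V \<noteq> W" using that by (auto simp: C_def D_def)
      then show ?thesis using no_bi[OF that] cl by (metis in_class_def)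
    qed
    then show ?thesis by blast
  qed
  \<comment> \<open>Partial solvability: the equations of one side alone, with \<open>Z\<close>
    pinned to \<open>z\<close>. Existential quantification over \<open>w\<close> makes
    \<open>E\<close> depend on the exogenous variables of \<open>C\<close> only.\<close>
  define E where "E b u \<longleftrightarrow> (\<exists>w. (\<forall>V\<in>C. w V = fn M V w u) \<and> (\<forall>V\<in>Z. w V = z V) \<and> (b \<longrightarrow> w Y = y))" for b u
  define F where "F b u \<longleftrightarrow> (\<exists>w. (\<forall>V\<in>D. w V = fn M V w u) \<and> (\<forall>V\<in>Z. w V = z V) \<and> (b \<longrightarrow> w X = x))" for b u
  have iff: "((\<forall>V\<in>Z. S u V = z V) \<and> (a \<longrightarrow> S u X = x) \<and> (b \<longrightarrow> S u Y = y)) \<longleftrightarrow> E b u \<and> F a u" (is "?l = ?r") for a b u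
  proof
    assume ?l
    then show ?r unfolding E_def F_def using solve_eq[OF wf cl, of u]
      by (intro conjI; intro exI[of _ "S u"]) (auto simp: S_def)
  next
    assume ?r
    then have "E b u" "F a u" by auto
    obtain w where w: "\<And>V. V \<in> C \<Longrightarrow> w V = fn M V w u" "\<And>V. V \<in> Z \<Longrightarrow> w V = z V" "b \<longrightarrow> w Y = y"
      using \<open>E b u\<close> unfolding E_def by blast
    obtain w' where w': "\<And>V. V \<in> D \<Longrightarrow> w' V = fn M V w' u" "\<And>V. V \<in> Z \<Longrightarrow> w' V = z V" "a \<longrightarrow> w' X = x"
      using \<open>F a u\<close> unfolding F_def by blast
    \<comment> \<open>Glue the two partial solutions. Parents cross between the sides only through
      \<open>Z\<close>, where both equal \<open>z\<close>, so \<open>t\<close> solves all equations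
      on \<open>A\<close>.\<close>
    define t where "t V = (if V \<in> C then w V else w' V)" for V
    have tZ: "t V = z V" if "V \<in> Z" for V using w(2) w'(2) that by (auto simp: t_def)
    have tA: "t V = fn M V t u" if "V \<in> A" for V
    proof (cases "V \<in> C")
      case True
      have "fn M V t u = fn M V w u"
      proof (rule in_class_fn_cong[OF cl])
        fix W assume "dir W V"
        then show "t W = w W" using C_par[OF True, of W] tZ[of W] w(2)[of W] by (cases "W \<in> Z") (auto simp: t_def)
      qed simp
      then show ?thesis using True w by (simp add: t_def)
    next
      case False
      then have VD: "V \<in> D" using that by (auto simp: C_def D_def)
      have "fn M V t u = fn M V w' u"
      proof (rule in_class_fn_cong[OF cl])
        fix W assume "dir W V"
        then show "t W = w' W" using D_par[OF VD, of W] tZ[of W] w'(2)[of W]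
          by (cases "W \<in> Z") (auto simp: t_def C_def D_def)
      qed simp
      then show ?thesis using False VD w' by (simp add: t_def)
    qed
    have "S u V = t V" if "V \<in> A" for V
      using wf A_par _ that
    proof (rule parent_closed_agree)
      fix V assume "V \<in> A" "\<And>W. dir W V \<Longrightarrow> S u W = t W"
      then have "fn M V (S u) u = fn M V t u" by (intro in_class_fn_cong[OF cl]) auto
      then show "S u V = t V" using tA[OF \<open>V \<in> A\<close>] solve_eq[OF wf cl, of u V] by (simp add: S_def)
    qed
    moreover have "t Y = w Y" "t X = w' X" using YC XD by (auto simp: t_def C_def D_def)
    ultimately show ?l using A_in tZ w(3) w'(3) by (auto simp: subset_iff)
  qed
  have fin: "finite (\<Union>V. uv M V)" using cl by (auto simp: in_class_def)
  have loc: "E b u = E b u'" if "\<And>i. i \<in> (\<Union>V\<in>C. uv M V) \<Longrightarrow> u i = u' i" for b u u'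
  proof -
    have "fn M V w u = fn M V w u'" if "V \<in> C" for V w
      by (rule in_class_fn_cong[OF cl]) (use that \<open>\<And>i. i \<in> (\<Union>V\<in>C. uv M V) \<Longrightarrow> u i = u' i\<close> in auto)
    then show ?thesis by (auto simp: E_def)
  qed
  have loc': "F b u = F b u'" if "\<And>i. i \<in> (\<Union>V\<in>D. uv M V) \<Longrightarrow> u i = u' i" for b u u'
  proof -
    have "fn M V w u = fn M V w u'" if "V \<in> D" for V w
      by (rule in_class_fn_cong[OF cl]) (use that \<open>\<And>i. i \<in> (\<Union>V\<in>D. uv M V) \<Longrightarrow> u i = u' i\<close> in auto)
    then show ?thesis by (auto simp: F_def)
  qed
  have "\<P> (\<lambda>u. (\<forall>V\<in>Z. S u V = z V) \<and> (a \<longrightarrow> S u X = x) \<and> (b \<longrightarrow> S u Y = y)) = \<P> (E b) * \<P> (F a)" for a b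
    unfolding iff \<P>_def exo_dist_def by (rule Pi_pmf_indep_events[OF fin disj loc loc'])
  from this[of True True] this[of True False] this[of False True] this[of False False]
  show ?thesis by simp
qed

section \<open>Sufficiency of the backdoor criterion\<close>

text \<open>The model in which the children of \<open>X\<close> read the constant \<open>x\<close> instead of \<open>X\<close>. It is a model of
  the diagram without the arrows out of \<open>X\<close> and carries the natural action together with the
  reward \<open>Y\<close> under \<open>do(x)\<close>.\<close>

definition freeze :: "'v scm \<Rightarrow> 'v \<Rightarrow> nat \<Rightarrow> 'v scm" where
  "freeze M X x = M\<lparr>pa := \<lambda>V. pa M V - {X}, fn := \<lambda>V v u. fn M V (v(X := x)) u\<rparr>"

lemma freeze_in_class:
  assumes "in_class dir bi M"
  shows "in_class (underline_graph dir X) bi (freeze M X x)"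
proof -
  have "fn M V (v(X := x)) u = fn M V (v'(X := x)) u'"
    if "\<forall>W\<in>pa M V - {X}. v W = v' W" "\<forall>i\<in>uv M V. u i = u' i" for V v v' u u'
    using that assms unfolding in_class_def by (auto elim!: allE[of _ V] simp: fun_upd_def)
  then show ?thesis using assms
    by (auto simp: in_class_def freeze_def underline_graph_def)
qed

lemma nondescendant_parent:
  assumes "V \<notin> descendants (bar_graph dir X) X" and "dir W V"
  shows "W \<notin> descendants (bar_graph dir X) X"
  using assms by (auto simp: descendants_def bar_graph_def intro: rtranclp.rtrancl_into_rtrancl)

lemma action_parent_nondescendant:
  assumes "\<forall>v. \<not> dir\<^sup>+\<^sup>+ v v" and "dir W X"
  shows "W \<notin> descendants (bar_graph dir X) X"
proof
  assume "W \<in> descendants (bar_graph dir X) X"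
  then have "(bar_graph dir X)\<^sup>*\<^sup>* X W" by (simp add: descendants_def)
  then have "dir\<^sup>*\<^sup>* X W" by (rule rtranclp_mono[THEN predicate2D, rotated]) (auto simp: bar_graph_def)
  then show False using assms rtranclp_into_tranclp1 by metis
qed

lemma solve_do_nondescendant:
  assumes "wfp dir" and "in_class dir bi M" and "V \<notin> descendants (bar_graph dir X) X"
  shows "solve_do M X u x V = solve M u V"
proof (rule parent_closed_agree[OF assms(1), of "- descendants (bar_graph dir X) X"])
  fix V W assume "V \<in> - descendants (bar_graph dir X) X" "dir W V"
  then show "W \<in> - descendants (bar_graph dir X) X" using nondescendant_parent[of V dir X W] by auto
next
  fix V assume V: "V \<in> - descendants (bar_graph dir X) X" and IH: "\<And>W. dir W V \<Longrightarrow> solve_do M X u x W = solve M u W"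
  have "V \<noteq> X" using V by (auto simp: descendants_def)
  have "fn M V (solve_do M X u x) u = fn M V (solve M u) u"
    by (rule in_class_fn_cong[OF assms(2)]) (use IH in auto)
  then show "solve_do M X u x V = solve M u V"
    using \<open>V \<noteq> X\<close> solve_eq[OF assms(1,2), of u V] solve_do_eq[OF assms(1,2), of X u x V] by simp
qed (use assms in simp)

text \<open>The consistency rule of potential outcomes: both sides satisfy the same
  equations.\<close>

lemma solve_do_consistent:
  assumes "wfp dir" and "in_class dir bi M"
  shows "solve_do M X u (solve M u X) = solve M u"
proof
  fix V
  show "solve_do M X u (solve M u X) V = solve M u V"
  proof (rule parent_closed_agree[OF assms(1), of UNIV])
    fix V assume "\<And>W. dir W V \<Longrightarrow> solve_do M X u (solve M u X) W = solve M u W"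
    then have "fn M V (solve_do M X u (solve M u X)) u = fn M V (solve M u) u"
      by (intro in_class_fn_cong[OF assms(2)]) auto
    then show "solve_do M X u (solve M u X) V = solve M u V"
      using solve_eq[OF assms, of u V] solve_do_eq[OF assms, of X u "solve M u X" V] by (cases "V = X") auto
  qed auto
qed

lemma wfp_underline: "wfp dir \<Longrightarrow> wfp (underline_graph dir X)"
  by (rule wfp_subset) (auto simp: underline_graph_def)

lemma solve_freeze:
  assumes ac: "\<forall>v. \<not> dir\<^sup>+\<^sup>+ v v" and wf: "wfp dir" and cl: "in_class dir bi M"
  shows "solve (freeze M X x) u V = (if V = X then solve M u X else solve_do M X u x V)"
proof -
  \<comment> \<open>The candidate takes the intervened values except at \<open>X\<close>, which
    keeps its natural value because its parents are not affected by the intervention.\<close>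
  define t where "t = (solve_do M X u x)(X := solve M u X)"
  have tx: "t(X := x) = solve_do M X u x" using solve_do_eq[OF wf cl, of X u x X] by (auto simp: t_def)
  have t: "t V = fn M V (t(X := x)) u" for V
  proof (cases "V = X")
    case True
    have "fn M X (solve_do M X u x) u = fn M X (solve M u) u"
    proof (rule in_class_fn_cong[OF cl])
      fix W assume "dir W X"
      then show "solve_do M X u x W = solve M u W"
        by (intro solve_do_nondescendant[OF wf cl] action_parent_nondescendant[OF ac])
    qed simp
    then show ?thesis using True solve_eq[OF wf cl, of u X] by (simp add: tx) (simp add: t_def)
  next
    case False
    then show ?thesis using solve_do_eq[OF wf cl, of X u x V] by (simp add: tx) (simp add: t_def)
  qed
  note cl' = freeze_in_class[OF cl, of X x]
  have "solve (freeze M X x) u V = t V"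
  proof (rule parent_closed_agree[OF wfp_underline[OF wf], of UNIV X])
    fix V assume "\<And>W. underline_graph dir X W V \<Longrightarrow> solve (freeze M X x) u W = t W"
    then have "fn (freeze M X x) V (solve (freeze M X x) u) u = fn (freeze M X x) V t u"
      by (intro in_class_fn_cong[OF cl']) auto
    then show "solve (freeze M X x) u V = t V"
      using solve_eq[OF wfp_underline[OF wf] cl', of u V] t[of V] by (simp add: freeze_def)
  qed auto
  then show ?thesis by (simp add: t_def)
qed

lemma potential_outcome_indep:
  fixes M :: "'v::finite scm"
  assumes ac: "\<forall>v. \<not> dir\<^sup>+\<^sup>+ v v" and cl: "in_class dir bi M"
    and ds: "dsep (underline_graph dir X) bi {Y} {X} Z"
    and Z: "Z \<subseteq> - descendants (bar_graph dir X) X" and Y: "Y \<notin> Z" "Y \<noteq> X"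
  defines "\<P> \<equiv> (\<lambda>Q. measure_pmf.prob (exo_dist M) {u. Q u})"
  shows "\<P> (\<lambda>u. (\<forall>V\<in>Z. solve M u V = z V) \<and> solve M u X = x \<and> solve M u Y = y) * \<P> (\<lambda>u. \<forall>V\<in>Z. solve M u V = z V) =
    \<P> (\<lambda>u. (\<forall>V\<in>Z. solve M u V = z V) \<and> solve M u X = x) *
    \<P> (\<lambda>u. (\<forall>V\<in>Z. solve M u V = z V) \<and> solve_do M X u x Y = y)"
proof -
  have wf: "wfp dir" using acyclic_wfp[OF ac] .
  have exo: "exo_dist (freeze M X x) = exo_dist M" by (simp add: exo_dist_def freeze_def)
  have "V \<noteq> X" if "V \<in> Z" for V using that Z by (auto simp: descendants_def)
  then have Zv: "solve (freeze M X x) u V = solve M u V" if "V \<in> Z" for u V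
    using that Z solve_freeze[OF ac wf cl] solve_do_nondescendant[OF wf cl] by auto
  have XY: "solve (freeze M X x) u X = solve M u X" "solve (freeze M X x) u Y = solve_do M X u x Y" for u
    using Y(2) solve_freeze[OF ac wf cl] by auto
  have "(solve M u X = x \<and> solve_do M X u x Y = y) = (solve M u X = x \<and> solve M u Y = y)" for u
    using solve_do_consistent[OF wf cl, of X u] by auto
  with dsep_cond_indep[OF wfp_underline[OF wf] freeze_in_class[OF cl] ds Y(1), of x z x y]
  show ?thesis by (simp add: exo \<P>_def Zv XY)
qed

text \<open>Grouping exogenous states by their covariates \<open>g u\<close> reduces the imitation
  identity to one equation per \<open>z\<close>.\<close>

lemma nn_integral_pmf_disintegrate:
  fixes F :: "'z \<Rightarrow> ennreal"
  shows "(\<integral>\<^sup>+u. F (g u) * indicator {u. B u} u \<partial>measure_pmf p) =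
    (\<integral>\<^sup>+z. F z * ennreal (measure_pmf.prob p {u. g u = z \<and> B u}) \<partial>count_space UNIV)"
proof -
  define r where "r = map_pmf (\<lambda>u. (g u, B u)) p"
  have r: "pmf r (z, True) = measure_pmf.prob p {u. g u = z \<and> B u}" for z
    by (simp add: r_def pmf_map vimage_def)
  have "(\<integral>\<^sup>+u. F (g u) * indicator {u. B u} u \<partial>measure_pmf p) =
      (\<integral>\<^sup>+zb. F (fst zb) * of_bool (snd zb) \<partial>measure_pmf r)"
    by (simp add: r_def indicator_def)
  also have "\<dots> = (\<integral>\<^sup>+z. \<integral>\<^sup>+b. ennreal (pmf r (z, b)) * (F z * of_bool b) \<partial>count_space UNIV \<partial>count_space UNIV)"
    by (simp add: nn_integral_measure_pmf nn_integral_fst_count_space[symmetric])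
  also have "\<dots> = (\<integral>\<^sup>+z. F z * ennreal (pmf r (z, True)) \<partial>count_space UNIV)"
    by (simp add: nn_integral_count_space_finite UNIV_bool mult.commute)
  finally show ?thesis by (simp add: r)
qed

text \<open>The definition of conditional probability in product form: if \<open>z\<close> has
  probability zero both sides vanish, so the default in \<open>cond_policy\<close> is
  harmless.\<close>

lemma cond_policy_prob:
  assumes "Z \<subseteq> Obs" "X \<in> Obs"
  shows "pmf (cond_policy X Z (obs_dist_O M Obs) z) x * measure_pmf.prob (exo_dist M) {u. \<forall>V\<in>Z. solve M u V = z V} =
    measure_pmf.prob (exo_dist M) {u. (\<forall>V\<in>Z. solve M u V = z V) \<and> solve M u X = x}"
    (is "_ * ?PZ = ?PXZ")
proof -
  let ?P = "obs_dist_O M Obs" and ?S = "{a. \<forall>V\<in>Z. a V = z V}"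
  have P: "?P = map_pmf (\<lambda>u. restrict (solve M u) Obs) (exo_dist M)"
    by (simp add: obs_dist_O_def obs_dist_def pmf.map_comp o_def)
  have mS: "measure_pmf.prob ?P ?S = ?PZ"
    unfolding P measure_map_pmf
    by (rule arg_cong[of _ _ "measure_pmf.prob _"]) (use assms in auto)
  have mSX: "measure_pmf.prob ?P (?S \<inter> {a. a X = x}) = ?PXZ"
    unfolding P measure_map_pmf
    by (rule arg_cong[of _ _ "measure_pmf.prob _"]) (use assms in auto)
  show ?thesis
  proof (cases "set_pmf ?P \<inter> ?S = {}")
    case True
    then have "?PZ = 0" unfolding mS[symmetric] by (simp add: measure_pmf_zero_iff)
    moreover have "?PXZ \<le> ?PZ" by (rule measure_pmf.finite_measure_mono) auto
    ultimately show ?thesis by (simp add: measure_le_0_iff)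
  next
    case False
    then have pos: "?PZ \<noteq> 0" unfolding mS[symmetric] by (simp add: measure_pmf_zero_iff)
    have "pmf (cond_policy X Z ?P z) x = measure_pmf.prob (cond_pmf ?P ?S) {a. a X = x}"
      using False by (simp add: cond_policy_def pmf_map vimage_def)
    also have "\<dots> = measure_pmf.prob ?P (?S \<inter> {a. a X = x}) / measure_pmf.prob ?P ?S"
      unfolding cond_pmf.rep_eq[OF False]
      by (rule measure_uniform_measure) (use pos mS in \<open>auto simp: measure_pmf.emeasure_eq_measure\<close>)
    finally show ?thesis using pos by (simp add: mS mSX)
  qed
qed

lemma cond_policy_in_space:
  assumes "Z \<subseteq> PaPi" shows "cond_policy X Z P \<in> policy_space PaPi"
proof -
  have "cond_policy X Z P w = cond_policy X Z P w'" if "\<forall>V\<in>PaPi. w V = w' V" for w w'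
  proof -
    have "{a. \<forall>V\<in>Z. a V = w V} = {a. \<forall>V\<in>Z. a V = w' V}"
      using that assms by (auto simp: subset_iff)
    then show ?thesis by (simp add: cond_policy_def)
  qed
  then show ?thesis by (simp add: policy_space_def)
qed

lemma ennreal_pmf_bind_nat:
  fixes q :: "'u \<Rightarrow> nat pmf"
  shows "ennreal (pmf (p \<bind> (\<lambda>u. q u \<bind> (\<lambda>x. return_pmf (f u x)))) y) =
    (\<Sum>x. \<integral>\<^sup>+u. ennreal (pmf (q u) x) * indicator {u. f u x = y} u \<partial>measure_pmf p)"
proof -
  have "ennreal (pmf (q u \<bind> (\<lambda>x. return_pmf (f u x))) y) =
      (\<Sum>x. ennreal (pmf (q u) x) * indicator {u. f u x = y} u)" for u
    unfolding ennreal_pmf_bind nn_integral_measure_pmf nn_integral_count_space_nat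
    by (intro arg_cong[of _ _ suminf] ext) (auto simp: indicator_def pmf_return)
  then show ?thesis by (simp add: ennreal_pmf_bind[of p] nn_integral_suminf)
qed

lemma backdoor_imitating:
  fixes dir bi :: "'v::finite \<Rightarrow> 'v \<Rightarrow> bool"
  assumes ac: "\<forall>v. \<not> dir\<^sup>+\<^sup>+ v v" and X: "X \<in> Obs" and Y: "Y \<notin> Obs"
    and Pa: "PaPi \<subseteq> Obs - descendants (bar_graph dir X) X"
    and Z: "Z \<subseteq> PaPi" and ds: "dsep (underline_graph dir X) bi {Y} {X} Z"
  shows "imitating_map dir bi Obs X Y PaPi (cond_policy X Z)"
  unfolding imitating_map_def
proof (intro allI impI conjI cond_policy_in_space[OF Z])
  fix M assume cl: "in_class dir bi M"
  have wf: "wfp dir" using acyclic_wfp[OF ac] .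
  let ?\<pi> = "cond_policy X Z (obs_dist_O M Obs)" and ?E = "exo_dist M"
  let ?\<P> = "\<lambda>Q. measure_pmf.prob ?E {u. Q u}"
  have ZN: "Z \<subseteq> - descendants (bar_graph dir X) X" and ZO: "Z \<subseteq> Obs" and YZ: "Y \<notin> Z" "Y \<noteq> X"
    using Z Pa X Y by auto
  define g where "g u = restrict (solve M u) Z" for u
  have g_eq: "g u = z \<longleftrightarrow> z \<in> extensional Z \<and> (\<forall>V\<in>Z. solve M u V = z V)" for u z
    by (auto simp: g_def extensional_def fun_eq_iff)
  have \<pi>g: "?\<pi> (solve_do M X u 0) = ?\<pi> (g u)" for u
  proof -
    have "\<forall>V\<in>Z. solve_do M X u 0 V = g u V"
      using ZN solve_do_nondescendant[OF wf cl] by (auto simp: g_def)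
    then show ?thesis using cond_policy_in_space[OF subset_refl, of X Z] unfolding policy_space_def by blast
  qed
  \<comment> \<open>The core identity \<open>\<pi>(x | z) P(z, Y_x = y) = P(z, x, y)\<close>; for
    \<open>z\<close> outside \<open>extensional Z\<close> both events are empty.\<close>
  have point: "ennreal (pmf (?\<pi> z) x) * ennreal (?\<P> (\<lambda>u. g u = z \<and> solve_do M X u x Y = y)) =
      ennreal (?\<P> (\<lambda>u. g u = z \<and> solve M u X = x \<and> solve M u Y = y))" for x y z
  proof (cases "z \<in> extensional Z")
    case True
    let ?pz = "?\<P> (\<lambda>u. \<forall>V\<in>Z. solve M u V = z V)"
    let ?pyz = "?\<P> (\<lambda>u. (\<forall>V\<in>Z. solve M u V = z V) \<and> solve_do M X u x Y = y)"
    let ?pxyz = "?\<P> (\<lambda>u. (\<forall>V\<in>Z. solve M u V = z V) \<and> solve M u X = x \<and> solve M u Y = y)"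
    have ci: "?pxyz * ?pz = pmf (?\<pi> z) x * ?pz * ?pyz"
      using potential_outcome_indep[OF ac cl ds ZN YZ, of z x y] cond_policy_prob[OF ZO X, of M z x] by simp
    have "pmf (?\<pi> z) x * ?pyz = ?pxyz"
    proof (cases "?pz = 0")
      case True
      have "?pyz \<le> ?pz" "?pxyz \<le> ?pz" by (auto intro!: measure_pmf.finite_measure_mono)
      then show ?thesis using True by (simp add: measure_le_0_iff)
    next
      case False
      then show ?thesis using ci by (simp add: algebra_simps)
    qed
    then show ?thesis using True by (simp add: g_eq ennreal_mult[symmetric])
  qed (simp add: g_eq)
  have inner: "(\<integral>\<^sup>+u. ennreal (pmf (?\<pi> (g u)) x) * indicator {u. solve_do M X u x Y = y} u \<partial>?E) =
      (\<integral>\<^sup>+u. indicator {x} (solve M u X) * indicator {u. solve M u Y = y} u \<partial>?E)" for x y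
  proof -
    have "(\<integral>\<^sup>+u. ennreal (pmf (?\<pi> (g u)) x) * indicator {u. solve_do M X u x Y = y} u \<partial>?E) =
        (\<integral>\<^sup>+z. 1 * ennreal (?\<P> (\<lambda>u. g u = z \<and> solve M u X = x \<and> solve M u Y = y)) \<partial>count_space UNIV)"
      unfolding nn_integral_pmf_disintegrate[where F = "\<lambda>z. ennreal (pmf (?\<pi> z) x)"] by (simp add: point)
    also have "\<dots> = (\<integral>\<^sup>+u. 1 * indicator {u. solve M u X = x \<and> solve M u Y = y} u \<partial>?E)"
      by (rule nn_integral_pmf_disintegrate[symmetric])
    also have "\<dots> = (\<integral>\<^sup>+u. indicator {x} (solve M u X) * indicator {u. solve M u Y = y} u \<partial>?E)"
      by (rule nn_integral_cong) (auto simp: indicator_def)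
    finally show ?thesis .
  qed
  show "map_pmf (\<lambda>v. v Y) (do_dist M X ?\<pi>) = map_pmf (\<lambda>v. v Y) (obs_dist M)"
  proof (rule pmf_eqI)
    fix y
    have "map_pmf (\<lambda>v. v Y) (do_dist M X ?\<pi>) =
        ?E \<bind> (\<lambda>u. ?\<pi> (g u) \<bind> (\<lambda>x. return_pmf (solve_do M X u x Y)))"
      by (simp add: do_dist_def map_bind_pmf \<pi>g)
    then have "ennreal (pmf (map_pmf (\<lambda>v. v Y) (do_dist M X ?\<pi>)) y) =
        (\<Sum>x. \<integral>\<^sup>+u. indicator {x} (solve M u X) * indicator {u. solve M u Y = y} u \<partial>?E)"
      by (simp only: ennreal_pmf_bind_nat inner)
    \<comment> \<open>Observation behaves like a policy with all mass on the natural action, so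
      \<open>ennreal_pmf_bind_nat\<close> can be read backwards.\<close>
    also have "\<dots> = (\<Sum>x. \<integral>\<^sup>+u. ennreal (pmf (return_pmf (solve M u X)) x) * indicator {u. solve M u Y = y} u \<partial>?E)"
      by (simp add: ennreal_indicator)
    also have "\<dots> = ennreal (pmf (?E \<bind> (\<lambda>u. return_pmf (solve M u X) \<bind> (\<lambda>x. return_pmf (solve M u Y)))) y)"
      by (rule ennreal_pmf_bind_nat[symmetric])
    also have "\<dots> = ennreal (pmf (map_pmf (\<lambda>v. v Y) (obs_dist M)) y)"
      by (simp add: obs_dist_def bind_return_pmf map_pmf_def[symmetric] pmf.map_comp o_def)
    finally show "pmf (map_pmf (\<lambda>v. v Y) (do_dist M X ?\<pi>)) y = pmf (map_pmf (\<lambda>v. v Y) (obs_dist M)) y"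
      by simp
  qed
qed

section \<open>Necessity of the backdoor criterion\<close>

lemma not_dsep_active_walk:
  assumes "\<not> dsep dir bi {Y} {X} Z"
  obtains n f g where "active_walk dir bi Z n f g" "f 0 = Y" "f n = X"
proof -
  obtain ns es where p: "is_path dir bi ns es" "hd ns = Y" "last ns = X" "\<not> blocked dir Z ns es"
    using assms by (auto simp: dsep_def)
  have len: "length ns = Suc (length es)" using p(1) by (simp add: is_path_def)
  then have "ns ! 0 = Y" "ns ! length es = X" using p(2,3)
    by (metis hd_conv_nth list.size(3) nat.distinct(1)) (metis p(3) len last_conv_nth list.size(3) nat.distinct(1) diff_Suc_1)
  moreover have "active_walk dir bi Z (length es) ((!) ns) ((!) es)"
    using p(1,4) by (auto simp: active_walk_def is_path_def blocked_def opened_def Let_def)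
  ultimately show ?thesis using that by blast
qed

text \<open>Following arrows along the walk leads to an end or to a collider. A collider has a
  descendant in \<open>Z\<close>, so either lies in \<open>S\<close>, and closure under parents
  leads back.\<close>

lemma active_walk_ancestral:
  assumes w: "active_walk dir bi Z n f g" and S: "\<And>V W. V \<in> S \<Longrightarrow> dir W V \<Longrightarrow> W \<in> S"
    and ends: "f 0 \<in> S" "f n \<in> S" and Z: "Z \<subseteq> S" and i: "i \<le> n"
  shows "f i \<in> S"
proof -
  have anc: "V \<in> S" if "dir\<^sup>*\<^sup>* V W" "W \<in> S" for V W
    using that by (induction rule: converse_rtranclp_induct) (auto intro: S)
  have edge: "\<And>k. k < n \<Longrightarrow> edge_ok dir bi (f k) (g k) (f (Suc k))"
    and op: "\<And>k. 0 < k \<Longrightarrow> k < n \<Longrightarrow> opened dir Z (head_right (g (k - 1))) (f k) (g k)"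
    using w by (auto simp: active_walk_def)
  have coll: "f k \<in> S" if k: "0 < k" "k < n" and "g (k - 1) \<noteq> Bwd" "g k \<noteq> Fwd" for k
    using op[OF k] that anc Z by (auto simp: opened_def head_left_def head_right_def descendants_def)
  have right: "k < n \<Longrightarrow> g k = Fwd \<Longrightarrow> f k \<in> S" for k
  proof (induction "n - k" arbitrary: k rule: less_induct)
    case less
    have "f (Suc k) \<in> S"
      using less coll[of "Suc k"] ends by (cases "Suc k = n"; cases "g (Suc k) = Fwd") auto
    then show ?case using S edge[of k] less.prems by (auto simp: edge_ok_def)
  qed
  have left: "k < n \<Longrightarrow> g k = Bwd \<Longrightarrow> f (Suc k) \<in> S" for k
  proof (induction k)
    case 0
    then show ?case using edge[of 0] ends S by (auto simp: edge_ok_def)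
  next
    case (Suc k)
    then have "f (Suc k) \<in> S" using coll[of "Suc k"] by (cases "g k = Bwd") auto
    then show ?case using S edge[of "Suc k"] Suc.prems by (auto simp: edge_ok_def)
  qed
  show ?thesis
    using i ends right[of i] left[of "i - 1"] coll[of i]
    by (cases "i = 0"; cases "i = n"; cases "g i = Fwd"; cases "g (i - 1) = Bwd") auto
qed

text \<open>A fair coin sits on every node and on every bidirected edge; \<open>to_nat {V}\<close> and
  \<open>to_nat {V, W}\<close> are their exogenous names. An edge of the active walk \<open>f, g\<close> uses the coin of
  its tail, or its own coin if it is bidirected. The two functions below are this coin as it is
  visible to the left and to the right end of the edge.\<close>

definition left_coin :: "(nat \<Rightarrow> 'v::finite) \<Rightarrow> (nat \<Rightarrow> edge_kind) \<Rightarrow> nat \<Rightarrow> ('v \<Rightarrow> nat) \<Rightarrow> (nat \<Rightarrow> nat) \<Rightarrow> nat" where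
  "left_coin f g i v u = (case g i of Fwd \<Rightarrow> u (to_nat {f i}) | Bwd \<Rightarrow> v (f (Suc i)) | Bid \<Rightarrow> u (to_nat {f i, f (Suc i)}))"

definition right_coin :: "(nat \<Rightarrow> 'v::finite) \<Rightarrow> (nat \<Rightarrow> edge_kind) \<Rightarrow> nat \<Rightarrow> ('v \<Rightarrow> nat) \<Rightarrow> (nat \<Rightarrow> nat) \<Rightarrow> nat" where
  "right_coin f g i v u = (case g i of Fwd \<Rightarrow> v (f i) | Bwd \<Rightarrow> u (to_nat {f (Suc i)}) | Bid \<Rightarrow> u (to_nat {f i, f (Suc i)}))"

definition edge_coin :: "(nat \<Rightarrow> 'v::finite) \<Rightarrow> (nat \<Rightarrow> edge_kind) \<Rightarrow> nat \<Rightarrow> (nat \<Rightarrow> nat) \<Rightarrow> nat" where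
  "edge_coin f g i u = (case g i of Fwd \<Rightarrow> u (to_nat {f i}) | Bwd \<Rightarrow> u (to_nat {f (Suc i)}) | Bid \<Rightarrow> u (to_nat {f i, f (Suc i)}))"

text \<open>The value of a node \<open>V\<close> is \<open>2 * a + c\<close>. The bit \<open>c\<close> is the coin of \<open>V\<close>, suppressed if the policy
  can see \<open>V\<close>. The counter \<open>a\<close> adds the parity of the walk coins at \<open>V\<close> to the counters of the nodes
  whose successor, in a tree \<open>succ\<close> directed towards \<open>Y\<close>, is \<open>V\<close>.\<close>

definition parity_scm :: "('v::finite \<Rightarrow> 'v \<Rightarrow> bool) \<Rightarrow> ('v \<Rightarrow> 'v \<Rightarrow> bool) \<Rightarrow> 'v set \<Rightarrow> 'v set \<Rightarrow> ('v \<Rightarrow> 'v) \<Rightarrow>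
    nat \<Rightarrow> (nat \<Rightarrow> 'v) \<Rightarrow> (nat \<Rightarrow> edge_kind) \<Rightarrow> 'v scm" where
  "parity_scm dir bi Vis T succ n f g =
    \<lparr>pa = \<lambda>V. {W. dir W V},
     uv = \<lambda>V. to_nat ` {{V, W} | W. W = V \<or> bi V W},
     pu = \<lambda>_. pmf_of_set {0, 1},
     fn = \<lambda>V v u. 2 * ((\<Sum>i<n. of_bool (f i = V) * left_coin f g i v u + of_bool (f (Suc i) = V) * right_coin f g i v u) mod 2
       + (\<Sum>W\<in>{W\<in>T. succ W = V}. v W div 2)) + (if V \<in> Vis then 0 else u (to_nat {V}) mod 2)\<rparr>"

text \<open>Names are injective codes of sets of one or two nodes, so distinct \<open>V\<close> and
  \<open>W\<close> can share only the name of \<open>{V, W}\<close>. Apart from its own coin, a node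
  reads only along edges.\<close>

lemma parity_scm_in_class:
  assumes "symp bi" and succ: "\<And>W. W \<in> T \<Longrightarrow> dir W (succ W)"
    and walk: "\<And>i. i < n \<Longrightarrow> edge_ok dir bi (f i) (g i) (f (Suc i))"
  shows "in_class dir bi (parity_scm dir bi Vis T succ n f g)" (is "in_class _ _ ?M")
proof -
  have uv: "to_nat {V, W} \<in> uv ?M V" if "W = V \<or> bi V W" for V W
    using that by (auto simp: parity_scm_def)
  have sym: "bi V W \<Longrightarrow> bi W V" for V W using assms(1) by (auto dest: sympD)
  have "uv ?M V \<inter> uv ?M W \<noteq> {} \<longleftrightarrow> bi V W" if "V \<noteq> W" for V W
  proof
    assume "uv ?M V \<inter> uv ?M W \<noteq> {}"
    then obtain i where "i \<in> uv ?M V" "i \<in> uv ?M W" by blast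
    then obtain A B where "i = to_nat {V, A}" "A = V \<or> bi V A" "i = to_nat {W, B}"
      unfolding parity_scm_def scm.simps by blast
    then have "{V, A} = {W, B}" "A = V \<or> bi V A" by simp_all
    then show "bi V W" using that by (auto simp: doubleton_eq_iff)
  next
    assume "bi V W"
    then show "uv ?M V \<inter> uv ?M W \<noteq> {}"
      using uv[of W V] uv[of V W] sym by (auto simp: insert_commute)
  qed
  moreover have "fn ?M V v u = fn ?M V v' u'"
    if v: "\<forall>W\<in>pa ?M V. v W = v' W" and u: "\<forall>i\<in>uv ?M V. u i = u' i" for V v v' u u'
  proof -
    have v: "v W = v' W" if "dir W V" for W using v that by (auto simp: parity_scm_def)
    have u: "u (to_nat {V, W}) = u' (to_nat {V, W})" if "W = V \<or> bi V W" for W using u uv[OF that] by blast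
    have uV: "u (to_nat {V}) = u' (to_nat {V})" using u[of V] by simp
    have "left_coin f g i v u = left_coin f g i v' u'" if "i < n" "f i = V" for i
      using walk[OF that(1)] that(2) u[of "f (Suc i)"] v uV
      by (auto simp: left_coin_def edge_ok_def split: edge_kind.splits)
    moreover have "right_coin f g i v u = right_coin f g i v' u'" if "i < n" "f (Suc i) = V" for i
      using walk[OF that(1)] that(2) u[of "f i"] v uV sym
      by (auto simp: right_coin_def edge_ok_def insert_commute split: edge_kind.splits)
    ultimately have "(\<Sum>i<n. of_bool (f i = V) * left_coin f g i v u + of_bool (f (Suc i) = V) * right_coin f g i v u) =
        (\<Sum>i<n. of_bool (f i = V) * left_coin f g i v' u' + of_bool (f (Suc i) = V) * right_coin f g i v' u')"
      by (intro sum.cong) auto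
    moreover have "(\<Sum>W\<in>{W\<in>T. succ W = V}. v W div 2) = (\<Sum>W\<in>{W\<in>T. succ W = V}. v' W div 2)"
      using succ v by (intro sum.cong) auto
    ultimately show ?thesis using uV by (simp add: parity_scm_def)
  qed
  ultimately show ?thesis by (auto simp: in_class_def) (auto simp: parity_scm_def)
qed

lemma imitable_backdoor:
  fixes dir bi :: "'v::finite \<Rightarrow> 'v \<Rightarrow> bool"
  assumes ac: "\<forall>v. \<not> dir\<^sup>+\<^sup>+ v v" and "symp bi" and XY: "X \<noteq> Y" and YPa: "Y \<notin> PaPi"
    and anc: "dir\<^sup>*\<^sup>* X Y" and im: "imitating_map dir bi Obs X Y PaPi \<Phi>"
  shows "\<exists>Z\<subseteq>PaPi. dsep (underline_graph dir X) bi {Y} {X} Z"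
proof (rule ccontr)
  assume no: "\<not> ?thesis"
  have wf: "wfp dir" using acyclic_wfp[OF ac] .
  define A where "A = {V. dir\<^sup>*\<^sup>* V Y}"
  have A_par: "W \<in> A" if "V \<in> A" "dir W V" for V W
    using that by (auto simp: A_def intro: converse_rtranclp_into_rtranclp)
  have A_in: "X \<in> A" "Y \<in> A" using anc by (auto simp: A_def)
  \<comment> \<open>Intersecting with \<open>A\<close> makes \<open>active_walk_ancestral\<close>
    applicable: the whole walk stays among the ancestors of \<open>Y\<close>.\<close>
  have "\<not> dsep (underline_graph dir X) bi {Y} {X} (PaPi \<inter> A)" using no by blast
  then obtain n f g where w: "active_walk (underline_graph dir X) bi (PaPi \<inter> A) n f g" and ends: "f 0 = Y" "f n = X"
    by (rule not_dsep_active_walk)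
  have edge: "\<And>i. i < n \<Longrightarrow> edge_ok (underline_graph dir X) bi (f i) (g i) (f (Suc i))"
    and op: "\<And>i. 0 < i \<Longrightarrow> i < n \<Longrightarrow> opened (underline_graph dir X) (PaPi \<inter> A) (head_right (g (i - 1))) (f i) (g i)"
    using w by (auto simp: active_walk_def)
  have fA: "f i \<in> A" if "i \<le> n" for i
    by (rule active_walk_ancestral[OF w _ _ _ _ that]) (use A_par A_in ends in \<open>auto simp: underline_graph_def\<close>)
  \<comment> \<open>A tail is a non-collider or the start \<open>Y\<close>. It lies in
    \<open>A\<close> and so, being outside \<open>PaPi \<inter> A\<close>, is invisible to the
    policy. It is not \<open>X\<close>, which emits no arrow here, so its value shows its coin even
    under intervention.\<close>
  have fwd: "f i \<notin> PaPi" "f i \<noteq> X" if i: "i < n" "g i = Fwd" for i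
  proof -
    show "f i \<noteq> X" using edge[OF i(1)] i by (auto simp: edge_ok_def underline_graph_def)
    show "f i \<notin> PaPi"
      using op[of i] i fA[of i] YPa ends by (cases "i = 0") (auto simp: opened_def head_left_def)
  qed
  have bwd: "f (Suc i) \<notin> PaPi" "f (Suc i) \<noteq> X" if i: "i < n" "g i = Bwd" for i
  proof -
    show *: "f (Suc i) \<noteq> X" using edge[OF i(1)] i by (auto simp: edge_ok_def underline_graph_def)
    then have "Suc i < n" using i ends by (metis Suc_lessI)
    then show "f (Suc i) \<notin> PaPi"
      using op[of "Suc i"] i fA[of "Suc i"] by (auto simp: opened_def head_right_def)
  qed
  have "\<exists>W. dir V W \<and> W \<in> A" if "V \<in> A - {Y}" for V
    using that by (auto simp: A_def elim: converse_rtranclpE)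
  then obtain succ where succ: "\<And>V. V \<in> A - {Y} \<Longrightarrow> dir V (succ V)" "\<And>V. V \<in> A - {Y} \<Longrightarrow> succ V \<in> A"
    by metis
  define M where "M = parity_scm dir bi PaPi (A - {Y}) succ n f g"
  have cl: "in_class dir bi M"
    unfolding M_def using assms(2) succ(1)
  proof (rule parity_scm_in_class)
    fix i assume "i < n"
    then show "edge_ok dir bi (f i) (g i) (f (Suc i))"
      using edge[of i] by (auto simp: edge_ok_def underline_graph_def split: edge_kind.splits)
  qed
  define \<epsilon> where "\<epsilon> V u = (\<Sum>i<n. of_bool (f i = V) * edge_coin f g i u + of_bool (f (Suc i) = V) * edge_coin f g i u) mod 2" for V u
  \<comment> \<open>The equation at \<open>X\<close> is assumed only when \<open>V = X\<close>, so
    this serves the natural and the intervened solution alike.\<close>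
  have step: "v V div 2 = \<epsilon> V u + (\<Sum>W\<in>{W\<in>A - {Y}. succ W = V}. v W div 2)"
      "v V mod 2 = (if V \<in> PaPi then 0 else u (to_nat {V}) mod 2)"
    if v: "\<And>V. V \<noteq> X \<Longrightarrow> v V = fn M V v u" and V: "v V = fn M V v u" for v u V
  proof -
    have c: "v W mod 2 = u (to_nat {W}) mod 2" if "W \<notin> PaPi" "W \<noteq> X" for W
      unfolding v[OF that(2)] using that(1) by (simp add: M_def parity_scm_def del: distrib_left_numeral)
    have "left_coin f g i v u mod 2 = edge_coin f g i u mod 2" "right_coin f g i v u mod 2 = edge_coin f g i u mod 2"
      if "i < n" for i
      using c fwd[OF that] bwd[OF that]
      by (auto simp: left_coin_def right_coin_def edge_coin_def split: edge_kind.splits)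
    then have "(of_bool (f i = V) * left_coin f g i v u + of_bool (f (Suc i) = V) * right_coin f g i v u) mod 2 =
        (of_bool (f i = V) * edge_coin f g i u + of_bool (f (Suc i) = V) * edge_coin f g i u) mod 2" if "i < n" for i
      using that by (intro mod_add_cong mod_mult_cong) auto
    then have "(\<Sum>i<n. of_bool (f i = V) * left_coin f g i v u + of_bool (f (Suc i) = V) * right_coin f g i v u) mod 2 = \<epsilon> V u"
      unfolding \<epsilon>_def by (subst (1 2) mod_sum_eq[symmetric]) (rule arg_cong2[of _ _ _ _ "(mod)"], rule sum.cong, auto)
    then have "v V = 2 * (\<epsilon> V u + (\<Sum>W\<in>{W\<in>A - {Y}. succ W = V}. v W div 2)) + (if V \<in> PaPi then 0 else u (to_nat {V}) mod 2)"
      by (subst V) (simp add: M_def parity_scm_def)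
    then show "v V div 2 = \<epsilon> V u + (\<Sum>W\<in>{W\<in>A - {Y}. succ W = V}. v W div 2)"
      "v V mod 2 = (if V \<in> PaPi then 0 else u (to_nat {V}) mod 2)"
      by (auto simp del: distrib_left_numeral)
  qed
  have fin: "finite A" by simp
  \<comment> \<open>Sum the counters over \<open>A\<close>. Every node but \<open>Y\<close> hands
    its counter to exactly one successor, so these cancel and the counter of \<open>Y\<close> is the
    sum of the parities, where each coin enters once from either end.\<close>
  have natural: "even (solve M u Y div 2)" for u
  proof -
    define a where "a V = solve M u V div 2" for V
    have a: "a V = \<epsilon> V u + (\<Sum>W\<in>{W\<in>A - {Y}. succ W = V}. a W)" for V
      unfolding a_def by (rule step) (rule solve_eq[OF wf cl])+
    have "a Y + sum a (A - {Y}) = sum a A" using A_in by (simp add: sum.remove[of A Y])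
    also have "\<dots> = (\<Sum>V\<in>A. \<epsilon> V u + (\<Sum>W\<in>{W\<in>A - {Y}. succ W = V}. a W))" using a by (rule sum.cong[OF refl])
    also have "\<dots> = (\<Sum>V\<in>A. \<epsilon> V u) + sum a (A - {Y})"
      unfolding sum.distrib using succ(2) by (subst sum.group) auto
    finally have "a Y = (\<Sum>V\<in>A. \<epsilon> V u)" by simp
    moreover have "(\<Sum>V\<in>A. \<epsilon> V u) mod 2 = (\<Sum>V\<in>A. \<Sum>i<n. of_bool (f i = V) * edge_coin f g i u + of_bool (f (Suc i) = V) * edge_coin f g i u) mod 2"
      unfolding \<epsilon>_def by (rule mod_sum_eq)
    moreover have "(\<Sum>V\<in>A. \<Sum>i<n. of_bool (f i = V) * edge_coin f g i u + of_bool (f (Suc i) = V) * edge_coin f g i u) =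
        (\<Sum>i<n. 2 * edge_coin f g i u)"
      using fA by (subst sum.swap, intro sum.cong) (auto simp: sum.distrib sum_distrib_right[symmetric] of_bool_def)
    ultimately have "a Y mod 2 = 0" by (simp add: sum_distrib_left[symmetric])
    then show ?thesis by (simp add: a_def even_iff_mod_2_eq_zero)
  qed
  define U where "U = (\<Union>V. uv M V)"
  \<comment> \<open>Outside \<open>U\<close> the product distribution has the default 0, so
    \<open>u1\<close> is 1 on \<open>U\<close> only.\<close>
  define u0 u1 :: "nat \<Rightarrow> nat" where "u0 = (\<lambda>_. 0)" and "u1 = (\<lambda>i. of_bool (i \<in> U))"
  have "finite U" using cl by (auto simp: in_class_def U_def)
  moreover have "pu M = (\<lambda>_. pmf_of_set {0, 1})" by (simp add: M_def parity_scm_def)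
  ultimately have supp: "u0 \<in> set_pmf (exo_dist M)" "u1 \<in> set_pmf (exo_dist M)"
    by (auto simp: exo_dist_def U_def[symmetric] set_Pi_pmf PiE_dflt_def u0_def u1_def)
  have coin1: "edge_coin f g i u1 = 1" if "i < n" for i
  proof -
    have "to_nat {V, W} \<in> U" if "W = V \<or> bi V W" for V W
      using that by (auto simp: U_def M_def parity_scm_def)
    from this[of "f i" "f i"] this[of "f (Suc i)" "f (Suc i)"] this[of "f (Suc i)" "f i"]
    show ?thesis using edge[OF that] by (auto simp: edge_coin_def edge_ok_def u1_def split: edge_kind.splits)
  qed
  have "edge_coin f g i u0 = 0" for i by (cases "g i") (simp_all add: edge_coin_def u0_def)
  then have \<epsilon>0: "\<epsilon> V u0 = 0" for V by (simp add: \<epsilon>_def)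
  have \<epsilon>1: "\<epsilon> V u1 = of_bool (V = Y)" if "V \<noteq> X" for V
  proof -
    \<comment> \<open>Visits to \<open>V\<close> as left end and as right end of an edge differ only
      through the two ends of the walk, so away from \<open>X\<close> their total is odd exactly at
      \<open>Y\<close>.\<close>
    have "(\<Sum>i<n. of_bool (f i = V)) + of_bool (f n = V) = of_bool (f 0 = V) + (\<Sum>i<n. of_bool (f (Suc i) = V) :: nat)"
      using sum.lessThan_Suc_shift[of "\<lambda>i. of_bool (f i = V) :: nat" n] by simp
    then have "(\<Sum>i<n. of_bool (f i = V)) = of_bool (V = Y) + (\<Sum>i<n. of_bool (f (Suc i) = V) :: nat)"
      using that ends by auto
    moreover have "\<epsilon> V u1 = ((\<Sum>i<n. of_bool (f i = V)) + (\<Sum>i<n. of_bool (f (Suc i) = V))) mod 2"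
      unfolding \<epsilon>_def sum.distrib[symmetric] by (intro arg_cong2[of _ _ _ _ "(mod)"] sum.cong) (auto simp: coin1)
    ultimately show ?thesis by (simp add: mult_2[symmetric])
  qed
  have do_fn: "solve_do M X u x V = fn M V (solve_do M X u x) u" if "V \<noteq> X" for u x V
    using solve_do_eq[OF wf cl, of X u x V] that by simp
  have do_step: "solve_do M X u x V div 2 = \<epsilon> V u + (\<Sum>W\<in>{W\<in>A - {Y}. succ W = V}. solve_do M X u x W div 2)"
    "solve_do M X u x V mod 2 = (if V \<in> PaPi then 0 else u (to_nat {V}) mod 2)" if "V \<noteq> X" for u x V
    using step[OF do_fn do_fn[OF that]] by auto
  \<comment> \<open>The counter of \<open>Y\<close> is never passed on, so the one changed parity
    reaches no other node.\<close>
  have same: "V \<noteq> Y \<longrightarrow> solve_do M X u0 x V div 2 = solve_do M X u1 x V div 2" for x V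
    using wf
  proof (induction V rule: wfp_induct_rule)
    case (less V)
    show ?case
    proof (cases "V = X")
      case True
      then show ?thesis using solve_do_eq[OF wf cl, of X _ x X] by simp
    next
      case False
      have "(\<Sum>W\<in>{W\<in>A - {Y}. succ W = V}. solve_do M X u0 x W div 2) = (\<Sum>W\<in>{W\<in>A - {Y}. succ W = V}. solve_do M X u1 x W div 2)"
        using less succ(1) by (intro sum.cong) auto
      then show ?thesis using do_step(1)[OF False, of _ x] \<epsilon>0 \<epsilon>1[OF False] by simp
    qed
  qed
  have flip: "solve_do M X u1 x Y div 2 = Suc (solve_do M X u0 x Y div 2)" for x
  proof -
    have "(\<Sum>W\<in>{W\<in>A - {Y}. succ W = Y}. solve_do M X u0 x W div 2) = (\<Sum>W\<in>{W\<in>A - {Y}. succ W = Y}. solve_do M X u1 x W div 2)"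
      using same by (intro sum.cong) auto
    then show ?thesis using do_step(1)[OF XY[symmetric], of _ x] \<epsilon>0 \<epsilon>1[OF XY[symmetric]] by simp
  qed
  define \<pi> where "\<pi> = \<Phi> (obs_dist_O M Obs)"
  have \<pi>: "\<pi> \<in> policy_space PaPi" "map_pmf (\<lambda>v. v Y) (do_dist M X \<pi>) = map_pmf (\<lambda>v. v Y) (obs_dist M)"
    using im cl by (auto simp: imitating_map_def \<pi>_def)
  \<comment> \<open>On the covariates the counters agree and the coins are suppressed.\<close>
  have "solve_do M X u0 0 V = solve_do M X u1 0 V" if "V \<in> PaPi" for V
  proof (cases "V = X")
    case True
    then show ?thesis using solve_do_eq[OF wf cl, of X _ 0 X] by simp
  next
    case False
    have "V \<noteq> Y" using that YPa by blast
    then show ?thesis using same[of V 0] do_step(2)[OF False, of _ 0] that by (metis div_mult_mod_eq)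
  qed
  then have "\<pi> (solve_do M X u0 0) = \<pi> (solve_do M X u1 0)"
    using \<pi>(1) unfolding policy_space_def by blast
  moreover obtain x where "x \<in> set_pmf (\<pi> (solve_do M X u0 0))" using set_pmf_not_empty by fast
  ultimately have x: "x \<in> set_pmf (\<pi> (solve_do M X u 0))" "u \<in> set_pmf (exo_dist M)" if "u \<in> {u0, u1}" for u
    using supp that by auto
  \<comment> \<open>One action \<open>x\<close> is possible in both states, so both rewards must
    occur under the natural law, where counters are even.\<close>
  have "solve_do M X u x Y \<in> set_pmf (map_pmf (\<lambda>v. v Y) (do_dist M X \<pi>))" if "u \<in> {u0, u1}" for u
    unfolding do_dist_def map_bind_pmf map_return_pmf set_bind_pmf set_return_pmf using x[OF that] by blast
  then have "even (solve_do M X u x Y div 2)" if "u \<in> {u0, u1}" for u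
    using that natural unfolding \<pi>(2) by (fastforce simp: obs_dist_def)
  from this[of u0] this[of u1] flip[of x] show False by simp
qed

theorem theorem2:
  fixes dir bi :: "'v::finite \<Rightarrow> 'v \<Rightarrow> bool" and Obs :: "'v set" and X Y :: 'v and PaPi :: "'v set"
  assumes "causal_diagram dir bi"
    and "X \<in> Obs" and "Y \<notin> Obs"
    and "Y \<in> descendants dir X"
    and "PaPi \<subseteq> Obs - descendants (bar_graph dir X) X"
  shows "(imitable dir bi Obs X Y PaPi \<longleftrightarrow>
           (\<exists>Z. Z \<subseteq> PaPi \<and> dsep (underline_graph dir X) bi {Y} {X} Z))
         \<and> (\<forall>Z. Z \<subseteq> PaPi \<and> dsep (underline_graph dir X) bi {Y} {X} Z \<longrightarrow>
              imitating_map dir bi Obs X Y PaPi (cond_policy X Z))"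
proof -
  have ac: "\<forall>v. \<not> dir\<^sup>+\<^sup>+ v v" and sym: "symp bi" using assms(1) by (auto simp: causal_diagram_def)
  have suff: "imitating_map dir bi Obs X Y PaPi (cond_policy X Z)"
    if "Z \<subseteq> PaPi" "dsep (underline_graph dir X) bi {Y} {X} Z" for Z
    by (rule backdoor_imitating[OF ac assms(2,3,5) that])
  have "\<exists>Z\<subseteq>PaPi. dsep (underline_graph dir X) bi {Y} {X} Z" if im: "imitable dir bi Obs X Y PaPi"
  proof -
    obtain \<Phi> where "imitating_map dir bi Obs X Y PaPi \<Phi>" using im by (auto simp: imitable_def)
    moreover have "X \<noteq> Y" "Y \<notin> PaPi" "dir\<^sup>*\<^sup>* X Y" using assms(2-5) by (auto simp: descendants_def)
    ultimately show ?thesis using imitable_backdoor[OF ac sym] by blast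
  qed
  then show ?thesis using suff unfolding imitable_def by blast
qed

end
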